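(* Consider the bilinear saddle point problem $\min_{x\in X}\max_{y\in Y}\mathcal L(x,y)$, $\mathcal L(x,y)=f(x)+\langle Ax,y\rangle-g(y)$. Assume that $f$ is strongly convex with modulus $\mu_f>0$ and $g$ is convex ($\mu_g=0$). Run the LPD method with the parameters $$\gamma_t=\frac t2+\frac{L_f}{\mu_f},\qquad \theta_{t-1}=\frac{t/2+L_f/\mu_f}{(t+1)/2+L_f/\mu_f},\qquad \frac1{\eta_t}=\mu_f\frac{t+1}{2}+L_f,\qquad \frac1{\tau_t}=\frac{4\|A\|^2}{\mu_f(t+1)/2}.$$ Then for every $K\ge1$ the output $\bar z_{K+1}=(\bar x_{K+1},\bar y_{K+1})$ satisfies, for all $z=(x,y)\in X\times Y$, $$Q(\bar z_{K+1},z)\le \frac{4}{K\left(K+3+4L_f/\mu_f\right)}\left(1+\frac{L_f}{\mu_f}\right)\left[\frac{\mu_f+L_f}{2}\|x-x_1\|^2+\frac{4\|A\|^2}{2\mu_f}\|y-y_1\|^2\right];$$ consequently $\mathrm{Gap}(\bar z_{K+1})=\max_{z\in X\times Y}Q(\bar z_{K+1},z)$ is at most the maximum over $(x,y)\in X\times Y$ of the right-hand side.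
   Context: $X\subseteq\mathbb R^n$, $Y\subseteq\mathbb R^m$ are nonempty compact convex sets; $f:X\to\mathbb R$ is convex and differentiable with $L_f$-Lipschitz gradient; $g:Y\to\mathbb R$ is convex (such that the minimizations below have solutions); $A\in\mathbb R^{m\times n}$ with operator norm $\|A\|$; $\|\cdot\|$ is the Euclidean norm. $f$ is strongly convex with modulus $\mu_f$ if $f(x')-f(x)-\langle\nabla f(x),x'-x\rangle\ge\frac{\mu_f}{2}\|x'-x\|^2$ for all $x,x'\in X$. For $\bar z=(\bar x,\bar y)$ and $z=(x,y)$ in $X\times Y$: $Q(\bar z,z)=\mathcal L(\bar x,y)-\mathcal L(x,\bar y)$, and $\mathrm{Gap}(\bar z)=\max_{z\in X\times Y}Q(\bar z,z)$. LPD method (step sizes enter only through their reciprocals): start with $\tilde x_1=x_1\in X$, $y_1\in Y$. For $t=1,\dots,K$: $y_{t+1}\in\arg\min_{y\in Y}\ \langle -A\tilde x_t,y\rangle+g(y)+\frac1{2\tau_t}\|y-y_t\|^2$; $x_{t+1}\in\arg\min_{x\in X}\ \langle\nabla f(x_t)+A^\top y_{t+1},x\rangle+\frac1{2\eta_t}\|x-x_t\|^2$; $\tilde x_{t+1}=x_{t+1}+\theta_t(x_{t+1}-x_t)$. Output: $\bar x_{K+1}=\frac{\sum_{t=1}^K\gamma_{t+1}x_{t+1}}{\sum_{t=1}^K\gamma_{t+1}}$, $\bar y_{K+1}=\frac{\sum_{t=1}^K\gamma_{t+1}y_{t+1}}{\sum_{t=1}^K\gamma_{t+1}}$. *)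

theory Defs
  imports "HOL-Analysis.Analysis"
begin

text \<open>
  \<open>gf\<close> is a gradient of \<open>f\<close> on \<open>X\<close>. The derivative is taken within \<open>X\<close>, since \<open>f\<close> is only
  given on \<open>X\<close>; no interior is assumed, so the choice of \<open>gf\<close> is kept as a parameter.
\<close>

definition gradient_on :: "'a::real_inner set \<Rightarrow> ('a \<Rightarrow> real) \<Rightarrow> ('a \<Rightarrow> 'a) \<Rightarrow> bool" where
  "gradient_on X f gf \<longleftrightarrow> (\<forall>x\<in>X. (f has_derivative (\<lambda>h. gf x \<bullet> h)) (at x within X))"

definition strongly_convex_on ::
  "'a::real_inner set \<Rightarrow> ('a \<Rightarrow> real) \<Rightarrow> ('a \<Rightarrow> 'a) \<Rightarrow> real \<Rightarrow> bool" where
  "strongly_convex_on X f gf \<mu> \<longleftrightarrow>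
     (\<forall>x\<in>X. \<forall>x'\<in>X. f x' - f x - gf x \<bullet> (x' - x) \<ge> \<mu> / 2 * (norm (x' - x))\<^sup>2)"

definition lagr ::
  "(real^'n \<Rightarrow> real) \<Rightarrow> (real^'m \<Rightarrow> real) \<Rightarrow> real^'n^'m \<Rightarrow> real^'n \<Rightarrow> real^'m \<Rightarrow> real" where
  "lagr f g A x y = f x + (A *v x) \<bullet> y - g y"

definition Qgap ::
  "(real^'n \<Rightarrow> real) \<Rightarrow> (real^'m \<Rightarrow> real) \<Rightarrow> real^'n^'m
    \<Rightarrow> (real^'n) \<times> (real^'m) \<Rightarrow> (real^'n) \<times> (real^'m) \<Rightarrow> real" where
  "Qgap f g A zbar z = lagr f g A (fst zbar) (snd z) - lagr f g A (fst z) (snd zbar)"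

text \<open>
  The maximum of \<open>Qgap f g A zbar\<close> is rendered as a supremum, because a convex \<open>g\<close> need not be
  lower semicontinuous at the boundary of \<open>Y\<close>; the two agree whenever the maximum is attained.
\<close>

definition Gap ::
  "(real^'n) set \<Rightarrow> (real^'m) set \<Rightarrow> (real^'n \<Rightarrow> real) \<Rightarrow> (real^'m \<Rightarrow> real) \<Rightarrow> real^'n^'m
    \<Rightarrow> (real^'n) \<times> (real^'m) \<Rightarrow> real" where
  "Gap X Y f g A zbar = (SUP z\<in>X \<times> Y. Qgap f g A zbar z)"

text \<open>
  The sequences are indexed from 1. \<open>rtau t\<close> and \<open>reta t\<close> stand for the reciprocals of the
  step sizes \<open>\<tau>\<^sub>t\<close> and \<open>\<eta>\<^sub>t\<close>, so that \<open>rtau t = 0\<close> (the case \<open>A = 0\<close>) makes sense.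
\<close>

definition LPD_run ::
  "(real^'n) set \<Rightarrow> (real^'m) set \<Rightarrow> (real^'n \<Rightarrow> real^'n) \<Rightarrow> (real^'m \<Rightarrow> real) \<Rightarrow> real^'n^'m
    \<Rightarrow> (nat \<Rightarrow> real) \<Rightarrow> (nat \<Rightarrow> real) \<Rightarrow> (nat \<Rightarrow> real) \<Rightarrow> nat
    \<Rightarrow> (nat \<Rightarrow> real^'n) \<Rightarrow> (nat \<Rightarrow> real^'n) \<Rightarrow> (nat \<Rightarrow> real^'m) \<Rightarrow> bool" where
  "LPD_run X Y gf g A \<theta> reta rtau K x xt y \<longleftrightarrow>
     x 1 \<in> X \<and> xt 1 = x 1 \<and> y 1 \<in> Y \<and>
     (\<forall>t\<in>{1..K}.
        is_arg_min (\<lambda>v. - (A *v xt t) \<bullet> v + g v + rtau t / 2 * (norm (v - y t))\<^sup>2)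
          (\<lambda>v. v \<in> Y) (y (t + 1)) \<and>
        is_arg_min (\<lambda>u. (gf (x t) + transpose A *v y (t + 1)) \<bullet> u
                          + reta t / 2 * (norm (u - x t))\<^sup>2)
          (\<lambda>u. u \<in> X) (x (t + 1)) \<and>
        xt (t + 1) = x (t + 1) + \<theta> t *\<^sub>R (x (t + 1) - x t))"

definition LPD_average :: "(nat \<Rightarrow> real) \<Rightarrow> nat \<Rightarrow> (nat \<Rightarrow> 'a::real_vector) \<Rightarrow> 'a" where
  "LPD_average \<gamma> K w = (\<Sum>t=1..K. \<gamma> (t + 1) *\<^sub>R w (t + 1)) /\<^sub>R (\<Sum>t=1..K. \<gamma> (t + 1))"

definition LPD_bound ::
  "real^'n^'m \<Rightarrow> real \<Rightarrow> real \<Rightarrow> nat \<Rightarrow> real^'n \<Rightarrow> real^'m \<Rightarrow> (real^'n) \<times> (real^'m) \<Rightarrow> real" where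
  "LPD_bound A Lf \<mu> K x1 y1 z =
     4 / (real K * (real K + 3 + 4 * Lf / \<mu>)) * (1 + Lf / \<mu>) *
       ((\<mu> + Lf) / 2 * (norm (fst z - x1))\<^sup>2
        + 4 * (onorm ((*v) A))\<^sup>2 / (2 * \<mu>) * (norm (snd z - y1))\<^sup>2)"

end

theory Submission
  imports Defs
begin

text \<open>
  Adding the prox inequality of the \<open>y\<close>-step, that of the \<open>x\<close>-step, and the two quadratic bounds
  on \<open>f\<close> gives one inequality per iteration. Weighted with \<open>c\<^sub>t = \<gamma>\<^bsub>t+1\<^esub>\<close> these telescope: since
  \<open>c\<^sub>t \<theta>\<^bsub>t-1\<^esub> = c\<^bsub>t-1\<^esub>\<close>, the bilinear terms of consecutive iterations match; since
  \<open>1/\<eta>\<^sub>t = \<mu>\<^sub>f c\<^sub>t\<close> and \<open>c\<^sub>t (c\<^sub>t - 1) \<le> (c\<^sub>t - 1/2)\<^sup>2 = c\<^bsub>t-1\<^esub>\<^sup>2\<close>, strong convexity takes care of the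
  distances in \<open>x\<close>; and \<open>c\<^sub>t / \<tau>\<^sub>t\<close> is nonincreasing. Young's inequality absorbs the remaining
  bilinear terms, since \<open>1/\<tau>\<^sub>t (1/\<eta>\<^sub>t - L\<^sub>f) = 4 \<parallel>A\<parallel>\<^sup>2\<close>. As \<open>Q\<close> is convex in its first argument, the
  bound passes to the averages.
\<close>

section \<open>Proximal steps\<close>

text \<open>The minimizer is compared with the points of the segment from \<open>p\<close> to
  \<open>v\<close>, so convexity of \<open>h\<close> replaces a subgradient. The case
  \<open>r = 0\<close> is covered; it occurs in the \<open>y\<close>-step when
  \<open>A = 0\<close>.\<close>

lemma prox_three_point:
  fixes h :: "'a::real_inner \<Rightarrow> real"
  assumes S: "convex S" and h: "convex_on S h"
    and p: "is_arg_min (\<lambda>u. h u + r / 2 * (norm (u - c))\<^sup>2) (\<lambda>u. u \<in> S) p"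
    and v: "v \<in> S"
  shows "h p + r / 2 * (norm (p - c))\<^sup>2 + r / 2 * (norm (v - p))\<^sup>2
           \<le> h v + r / 2 * (norm (v - c))\<^sup>2"
proof -
  have pS: "p \<in> S" and min: "\<And>u. u \<in> S \<Longrightarrow>
      h p + r / 2 * (norm (p - c))\<^sup>2 \<le> h u + r / 2 * (norm (u - c))\<^sup>2"
    using p by (auto simp: is_arg_min_linorder)
  have exp: "(norm (p - c + s *\<^sub>R (v - p)))\<^sup>2
      = (norm (p - c))\<^sup>2 + 2 * s * ((p - c) \<bullet> (v - p)) + s\<^sup>2 * (norm (v - p))\<^sup>2" for s
    unfolding power2_norm_eq_inner
    by (simp only: inner_add_left inner_add_right inner_scaleR_left inner_scaleR_right
        inner_commute[of "v - p" "p - c"]) (simp add: power2_eq_square algebra_simps)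
  have step: "h p - h v \<le> r * ((p - c) \<bullet> (v - p)) + s * (r / 2 * (norm (v - p))\<^sup>2)"
    if s: "0 < s" "s \<le> 1" for s
  proof -
    define u where "u = (1 - s) *\<^sub>R p + s *\<^sub>R v"
    have uS: "u \<in> S"
      unfolding u_def using S pS v s by (simp add: convexD_alt)
    have hu: "h u \<le> (1 - s) * h p + s * h v"
      unfolding u_def using convex_onD[OF h, of s p v] s pS v by auto
    have uc: "u - c = p - c + s *\<^sub>R (v - p)"
      unfolding u_def by (simp add: algebra_simps)
    have "h p + r / 2 * (norm (p - c))\<^sup>2 \<le> (1 - s) * h p + s * h v
        + r / 2 * ((norm (p - c))\<^sup>2 + 2 * s * ((p - c) \<bullet> (v - p)) + s\<^sup>2 * (norm (v - p))\<^sup>2)"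
      using min[OF uS] hu unfolding uc exp by linarith
    then have "s * (h p - h v) \<le> s * (r * ((p - c) \<bullet> (v - p)) + s * (r / 2 * (norm (v - p))\<^sup>2))"
      by (simp add: algebra_simps power2_eq_square)
    then show ?thesis using s by simp
  qed
  \<comment> \<open>Division by \<open>s\<close> has left one term linear in \<open>s\<close>;
    letting \<open>s\<close> tend to 0 from the right yields the variational inequality at
    \<open>p\<close>.\<close>
  have "((\<lambda>s. r * ((p - c) \<bullet> (v - p)) + s * (r / 2 * (norm (v - p))\<^sup>2))
      \<longlongrightarrow> r * ((p - c) \<bullet> (v - p)) + 0 * (r / 2 * (norm (v - p))\<^sup>2)) (at_right 0)"
    by (intro tendsto_intros)
  moreover have "\<forall>\<^sub>F s in at_right 0.
      h p - h v \<le> r * ((p - c) \<bullet> (v - p)) + s * (r / 2 * (norm (v - p))\<^sup>2)"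
    unfolding eventually_at_right_field by (intro exI[of _ 1] conjI allI impI step) auto
  ultimately have "h p - h v \<le> r * ((p - c) \<bullet> (v - p))"
    using tendsto_lowerbound by fastforce
  \<comment> \<open>Since \<open>p - c + (v - p) = v - c\<close>, the expansion at
    \<open>s = 1\<close> trades the inner product for the three squared distances.\<close>
  moreover have "(norm (v - c))\<^sup>2
      = (norm (p - c))\<^sup>2 + 2 * ((p - c) \<bullet> (v - p)) + (norm (v - p))\<^sup>2"
    using exp[of 1] by simp
  then have "r / 2 * (norm (v - c))\<^sup>2
      = r / 2 * (norm (p - c))\<^sup>2 + r * ((p - c) \<bullet> (v - p)) + r / 2 * (norm (v - p))\<^sup>2"
    by (simp add: distrib_left)
  ultimately show ?thesis by linarith
qed

lemma convex_on_inner_left: "convex S \<Longrightarrow> convex_on S (\<lambda>u. b \<bullet> u)"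
  by (simp add: convex_on_def inner_right_distrib)

section \<open>Quadratic and bilinear estimates\<close>

text \<open>Along the segment from \<open>u\<close> to \<open>v\<close>, the function minus its
  quadratic majorant has nonpositive derivative, so the mean value theorem suffices and no integral
  is taken.\<close>

lemma lipschitz_gradient_upper_bound:
  assumes X: "convex X" and grad: "gradient_on X f gf" and lip: "L-lipschitz_on X gf"
    and u: "u \<in> X" and v: "v \<in> X"
  shows "f v \<le> f u + gf u \<bullet> (v - u) + L / 2 * (norm (v - u))\<^sup>2"
proof -
  define d where "d = v - u"
  define \<phi> where "\<phi> = (\<lambda>s. f (u + s *\<^sub>R d) - s * (gf u \<bullet> d) - L / 2 * s\<^sup>2 * (norm d)\<^sup>2)"
  define \<phi>' where "\<phi>' = (\<lambda>s h. gf (u + s *\<^sub>R d) \<bullet> (h *\<^sub>R d) - h * (gf u \<bullet> d) - L * s * h * (norm d)\<^sup>2)"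
  have seg: "u + s *\<^sub>R d \<in> X" if "s \<in> {0..1}" for s
  proof -
    have "u + s *\<^sub>R d = (1 - s) *\<^sub>R u + s *\<^sub>R v" by (simp add: d_def algebra_simps)
    then show ?thesis using X u v that by (simp add: convexD_alt)
  qed
  have "(\<phi> has_derivative \<phi>' s) (at s within {0..1})" if s: "0 \<le> s" "s \<le> 1" for s
  proof -
    have "(f has_derivative (\<lambda>h. gf (u + s *\<^sub>R d) \<bullet> h)) (at (u + s *\<^sub>R d) within X)"
      using grad seg[of s] s by (simp add: gradient_on_def)
    \<comment> \<open>The derivative is known only within \<open>X\<close>; the chain rule wants it
      within the image of the parameter interval, a subset of \<open>X\<close> by convexity.\<close>
    then have f': "(f has_derivative (\<lambda>h. gf (u + s *\<^sub>R d) \<bullet> h))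
        (at (u + s *\<^sub>R d) within (\<lambda>s. u + s *\<^sub>R d) ` {0..1})"
      by (rule has_derivative_subset) (use seg in auto)
    have "((\<lambda>s. u + s *\<^sub>R d) has_derivative (\<lambda>h. h *\<^sub>R d)) (at s within {0..1})"
      by (auto intro!: derivative_eq_intros)
    from has_derivative_in_compose[OF this f']
    have "((\<lambda>s. f (u + s *\<^sub>R d)) has_derivative (\<lambda>h. gf (u + s *\<^sub>R d) \<bullet> (h *\<^sub>R d)))
        (at s within {0..1})" .
    then show ?thesis
      unfolding \<phi>_def \<phi>'_def by (auto intro!: derivative_eq_intros simp: algebra_simps)
  qed
  from mvt_very_simple[of 0 1 \<phi>, OF _ this]
  obtain s where s: "s \<in> {0..1}" and eq: "\<phi> 1 - \<phi> 0 = \<phi>' s 1" by auto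
  have "(gf (u + s *\<^sub>R d) - gf u) \<bullet> d \<le> norm (gf (u + s *\<^sub>R d) - gf u) * norm d"
    by (rule norm_cauchy_schwarz)
  also have "\<dots> \<le> (L * norm (s *\<^sub>R d)) * norm d"
    using lipschitz_onD[OF lip seg[OF s] u] by (intro mult_right_mono) (auto simp: dist_norm)
  also have "\<dots> = L * s * (norm d)\<^sup>2"
    using s by (simp add: power2_eq_square)
  finally have "\<phi>' s 1 \<le> 0"
    by (simp add: \<phi>'_def inner_diff_left)
  with eq show ?thesis
    by (simp add: \<phi>_def d_def)
qed

text \<open>Expand the square of \<open>sqrt p * u - sqrt q * v\<close>. The condition on
  \<open>a\<close> is stated as a product, without division, so that \<open>p\<close> or
  \<open>q\<close> may vanish.\<close>

lemma weighted_young: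
  fixes a p q u v :: real
  assumes "0 \<le> p" "0 \<le> q" "0 \<le> u" "0 \<le> v" "a\<^sup>2 \<le> p * q"
  shows "a * (u * v) \<le> p / 2 * u\<^sup>2 + q / 2 * v\<^sup>2"
proof -
  have "a \<le> sqrt p * sqrt q"
    using assms(5) by (metis real_le_rsqrt real_sqrt_mult)
  then have "a * (u * v) \<le> (sqrt p * sqrt q) * (u * v)"
    using assms by (intro mult_right_mono) auto
  moreover have "0 \<le> (sqrt p * u - sqrt q * v)\<^sup>2" by simp
  ultimately show ?thesis
    using assms(1,2) by (simp add: power2_diff power_mult_distrib algebra_simps)
qed

text \<open>The first form absorbs the cross term between consecutive iterations, the second the
  bilinear term left over after the last one.\<close>

lemma matrix_inner_young:
  fixes A :: "real^'n^'m"
  assumes "0 \<le> p" "0 \<le> q" "(w * onorm ((*v) A))\<^sup>2 \<le> p * q" "0 \<le> w"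
  shows "w * ((A *v d) \<bullet> e) \<le> p / 2 * (norm d)\<^sup>2 + q / 2 * (norm e)\<^sup>2"
    and "- (w * ((A *v d) \<bullet> e)) \<le> p / 2 * (norm d)\<^sup>2 + q / 2 * (norm e)\<^sup>2"
proof -
  have "\<bar>(A *v d) \<bullet> e\<bar> \<le> norm (A *v d) * norm e" by (rule Cauchy_Schwarz_ineq2)
  also have "\<dots> \<le> (onorm ((*v) A) * norm d) * norm e"
    by (intro mult_right_mono onorm matrix_vector_mul_bounded_linear) auto
  finally have "w * \<bar>(A *v d) \<bullet> e\<bar> \<le> w * ((onorm ((*v) A) * norm d) * norm e)"
    using assms(4) by (rule mult_left_mono)
  also have "\<dots> = w * onorm ((*v) A) * (norm d * norm e)" by simp
  also have "\<dots> \<le> p / 2 * (norm d)\<^sup>2 + q / 2 * (norm e)\<^sup>2"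
    using assms by (intro weighted_young) auto
  finally have *: "\<bar>w * ((A *v d) \<bullet> e)\<bar> \<le> p / 2 * (norm d)\<^sup>2 + q / 2 * (norm e)\<^sup>2"
    using assms(4) by (simp add: abs_mult)
  then show "w * ((A *v d) \<bullet> e) \<le> p / 2 * (norm d)\<^sup>2 + q / 2 * (norm e)\<^sup>2"
    and "- (w * ((A *v d) \<bullet> e)) \<le> p / 2 * (norm d)\<^sup>2 + q / 2 * (norm e)\<^sup>2"
    by linarith+
qed

lemma inner_transpose_matrix_vector:
  fixes A :: "real^'n^'m"
  shows "(transpose A *v w) \<bullet> b = (A *v b) \<bullet> w"
  unfolding transpose_matrix_vector dot_lmul_matrix by (rule inner_commute)

section \<open>One iteration of the method\<close>

text \<open>The gradient terms at \<open>xt\<close> cancel between the \<open>x\<close>-step, the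
  upper bound at \<open>x'\<close> and strong convexity at \<open>u\<close>. Of the bilinear terms
  only the mismatch between the new point \<open>x'\<close> and the extrapolated point
  \<open>w\<close> used in the \<open>y\<close>-step survives.\<close>

lemma LPD_step:
  fixes A :: "real^'n^'m"
  assumes X: "convex X" and Y: "convex Y"
    and grad: "gradient_on X f gf" and lip: "L-lipschitz_on X gf"
    and sc: "strongly_convex_on X f gf \<mu>" and g: "convex_on Y g"
    and xt: "xt \<in> X"
    and y': "is_arg_min (\<lambda>v. - (A *v w) \<bullet> v + g v + rt / 2 * (norm (v - yt))\<^sup>2) (\<lambda>v. v \<in> Y) y'"
    and x': "is_arg_min (\<lambda>u. (gf xt + transpose A *v y') \<bullet> u + re / 2 * (norm (u - xt))\<^sup>2)
               (\<lambda>u. u \<in> X) x'"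
    and u: "u \<in> X" and v: "v \<in> Y"
  shows "Qgap f g A (x', y') (u, v) + (A *v (x' - w)) \<bullet> (y' - v)
      + re / 2 * (norm (u - x'))\<^sup>2 + (re - L) / 2 * (norm (x' - xt))\<^sup>2
      + rt / 2 * (norm (v - y'))\<^sup>2 + rt / 2 * (norm (y' - yt))\<^sup>2
    \<le> (re - \<mu>) / 2 * (norm (u - xt))\<^sup>2 + rt / 2 * (norm (v - yt))\<^sup>2"
proof -
  have x'X: "x' \<in> X" using x' by (simp add: is_arg_min_def)
  have "- (A *v w) \<bullet> y' + g y' + rt / 2 * (norm (y' - yt))\<^sup>2 + rt / 2 * (norm (v - y'))\<^sup>2
      \<le> - (A *v w) \<bullet> v + g v + rt / 2 * (norm (v - yt))\<^sup>2"
    using y' v by (intro prox_three_point[OF Y convex_on_add[OF convex_on_inner_left[OF Y] g]])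
  moreover have "(gf xt + transpose A *v y') \<bullet> x' + re / 2 * (norm (x' - xt))\<^sup>2
        + re / 2 * (norm (u - x'))\<^sup>2
      \<le> (gf xt + transpose A *v y') \<bullet> u + re / 2 * (norm (u - xt))\<^sup>2"
    using x' u by (intro prox_three_point[OF X convex_on_inner_left[OF X]])
  moreover have "f x' \<le> f xt + gf xt \<bullet> (x' - xt) + L / 2 * (norm (x' - xt))\<^sup>2"
    by (rule lipschitz_gradient_upper_bound[OF X grad lip xt x'X])
  moreover have "f u - f xt - gf xt \<bullet> (u - xt) \<ge> \<mu> / 2 * (norm (u - xt))\<^sup>2"
    using sc xt u by (simp add: strongly_convex_on_def)
  moreover have "(transpose A *v y') \<bullet> b = (A *v b) \<bullet> y'" for b
    by (rule inner_transpose_matrix_vector)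
  ultimately show ?thesis
    unfolding Qgap_def lagr_def
    by (simp add: inner_add_left inner_diff_left inner_diff_right matrix_vector_mult_diff_distrib
        field_simps)
qed

section \<open>Averaged iterates and the total weight\<close>

lemma LPD_average_convex_on:
  assumes "convex_on S h" "\<And>t. t \<in> {1..K} \<Longrightarrow> w (t + 1) \<in> S"
    and "\<And>t. t \<in> {1..K} \<Longrightarrow> 0 \<le> \<gamma> (t + 1)" "0 < (\<Sum>t=1..K. \<gamma> (t + 1))"
  shows "(\<Sum>t=1..K. \<gamma> (t + 1)) * h (LPD_average \<gamma> K w) \<le> (\<Sum>t=1..K. \<gamma> (t + 1) * h (w (t + 1)))"
proof -
  let ?G = "\<Sum>t=1..K. \<gamma> (t + 1)"
  have ne: "{1..K} \<noteq> {}" using assms(4) by (metis less_irrefl sum.empty)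
  have "LPD_average \<gamma> K w = (\<Sum>t=1..K. (\<gamma> (t + 1) / ?G) *\<^sub>R w (t + 1))"
    by (simp add: LPD_average_def scaleR_sum_right divide_inverse mult.commute)
  then have "h (LPD_average \<gamma> K w) = h (\<Sum>t=1..K. (\<gamma> (t + 1) / ?G) *\<^sub>R w (t + 1))" by simp
  also have "\<dots> \<le> (\<Sum>t=1..K. (\<gamma> (t + 1) / ?G) * h (w (t + 1)))"
    using assms ne by (intro convex_on_sum[where C=S]) (auto simp: sum_divide_distrib[symmetric])
  also have "\<dots> = (\<Sum>t=1..K. \<gamma> (t + 1) * h (w (t + 1))) / ?G"
    by (simp add: sum_divide_distrib)
  finally show ?thesis using assms(4) by (simp add: field_simps)
qed

text \<open>For fixed \<open>z\<close> the gap is a convex function of the first block plus a convex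
  function of the second, up to a constant, so Jensen's inequality is applied to each block
  separately.\<close>

lemma Qgap_average_le:
  fixes A :: "real^'n^'m"
  assumes X: "convex X" and Y: "convex Y" and f: "convex_on X f" and g: "convex_on Y g"
    and x: "\<And>t. t \<in> {1..K} \<Longrightarrow> x (t + 1) \<in> X" and y: "\<And>t. t \<in> {1..K} \<Longrightarrow> y (t + 1) \<in> Y"
    and \<gamma>: "\<And>t. t \<in> {1..K} \<Longrightarrow> 0 \<le> \<gamma> (t + 1)" "0 < (\<Sum>t=1..K. \<gamma> (t + 1))"
  shows "(\<Sum>t=1..K. \<gamma> (t + 1)) * Qgap f g A (LPD_average \<gamma> K x, LPD_average \<gamma> K y) z
    \<le> (\<Sum>t=1..K. \<gamma> (t + 1) * Qgap f g A (x (t + 1), y (t + 1)) z)"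
proof -
  have Fx: "convex_on X (\<lambda>u. f u + (transpose A *v snd z) \<bullet> u)"
    by (intro convex_on_add f convex_on_inner_left X)
  have Fy: "convex_on Y (\<lambda>v. g v + (- (A *v fst z)) \<bullet> v)"
    by (intro convex_on_add g convex_on_inner_left Y)
  have Q: "Qgap f g A (u, v) z = (f u + (transpose A *v snd z) \<bullet> u)
      + (g v + (- (A *v fst z)) \<bullet> v) - (g (snd z) + f (fst z))" for u v
    by (simp add: Qgap_def lagr_def inner_transpose_matrix_vector del: transpose_matrix_vector)
  show ?thesis
    using LPD_average_convex_on[where \<gamma>=\<gamma> and w=x and K=K, OF Fx x \<gamma>]
      LPD_average_convex_on[where \<gamma>=\<gamma> and w=y and K=K, OF Fy y \<gamma>]
    unfolding Q by (simp add: distrib_left right_diff_distrib sum.distrib sum_subtractf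
        flip: sum_distrib_right)
qed

lemma continuous_LPD_bound: "continuous_on S (LPD_bound A L \<mu> K x1 y1)"
  unfolding LPD_bound_def by (intro continuous_intros)

text \<open>With \<open>\<kappa> = Lf / \<mu>\<close> this is the total weight of the average; its
  reciprocal is the leading factor of \<open>LPD_bound\<close>.\<close>

lemma sum_LPD_weights:
  "(\<Sum>t=1..K. real (t + 1) / 2 + \<kappa>) = real K * (real K + 3 + 4 * \<kappa>) / 4"
  by (induction K) (auto simp: field_simps)

section \<open>Weighted telescoping\<close>

lemma LPD_telescope:
  fixes A :: "real^'n^'m" and \<mu> L :: real and K :: nat
  defines "c \<equiv> \<lambda>t::nat. (real t + 1) / 2 + L / \<mu>"
  assumes X: "convex X" and Y: "convex Y"
    and grad: "gradient_on X f gf" and lip: "L-lipschitz_on X gf"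
    and \<mu>: "\<mu> > 0" and sc: "strongly_convex_on X f gf \<mu>" and g: "convex_on Y g"
    and \<theta>: "\<And>t. t \<ge> 1 \<Longrightarrow> \<theta> (t - 1) = (real t / 2 + L / \<mu>) / ((real t + 1) / 2 + L / \<mu>)"
    and reta: "\<And>t. t \<ge> 1 \<Longrightarrow> reta t = \<mu> * ((real t + 1) / 2) + L"
    and rtau: "\<And>t. t \<ge> 1 \<Longrightarrow> rtau t = 4 * (onorm ((*v) A))\<^sup>2 / (\<mu> * ((real t + 1) / 2))"
    and K: "K \<ge> 1"
    and run: "LPD_run X Y gf g A \<theta> reta rtau K x xt y"
    and u: "u \<in> X" and v: "v \<in> Y"
  shows "(\<Sum>t=1..K. c t * Qgap f g A (x (t + 1), y (t + 1)) (u, v))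
    \<le> (1 + L / \<mu>) * ((\<mu> + L) / 2 * (norm (u - x 1))\<^sup>2
        + 4 * (onorm ((*v) A))\<^sup>2 / (2 * \<mu>) * (norm (v - y 1))\<^sup>2)" (is "_ \<le> ?B")
proof -
  define a where "a = onorm ((*v) A)"
  define m where "m = (\<lambda>t::nat. \<mu> * ((real t + 1) / 2))"
  define \<kappa> where "\<kappa> = L / \<mu>"
  define q where "q = (\<lambda>t. Qgap f g A (x (t + 1), y (t + 1)) (u, v))"
  have L: "0 \<le> L" using lip by (rule lipschitz_on_nonneg)
  have \<kappa>: "0 \<le> \<kappa>" using L \<mu> by (simp add: \<kappa>_def)
  have c: "c t = (real t + 1) / 2 + \<kappa>" for t by (simp add: c_def \<kappa>_def)
  have c_pos: "0 < c t" for t using \<kappa> by (simp add: c add_pos_nonneg)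
  have m_pos: "0 < m t" for t using \<mu> by (simp add: m_def)
  \<comment> \<open>\<open>m t\<close> is what remains of \<open>reta t\<close> once the Lipschitz
    term of the quadratic upper bound has been paid for.\<close>
  have re: "reta t = \<mu> * c t" "reta t - L = m t" if "t \<ge> 1" for t
    using reta[OF that] \<mu> by (auto simp: c m_def \<kappa>_def field_simps)
  have rt: "rtau t = 4 * a\<^sup>2 / m t" if "t \<ge> 1" for t
    using rtau[OF that] by (simp add: a_def m_def)
  have rt_nonneg: "0 \<le> rtau t" if "t \<ge> 1" for t
    using rt[OF that] m_pos[of t] by simp
  have yA: "is_arg_min (\<lambda>v. - (A *v xt t) \<bullet> v + g v + rtau t / 2 * (norm (v - y t))\<^sup>2)
          (\<lambda>v. v \<in> Y) (y (t + 1))"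
    and xA: "is_arg_min (\<lambda>u. (gf (x t) + transpose A *v y (t + 1)) \<bullet> u
                          + reta t / 2 * (norm (u - x t))\<^sup>2) (\<lambda>u. u \<in> X) (x (t + 1))"
    and xtS: "xt (t + 1) = x (t + 1) + \<theta> t *\<^sub>R (x (t + 1) - x t)"
    if "t \<in> {1..K}" for t
    using run that unfolding LPD_run_def by blast+
  have xX: "x t \<in> X" if "1 \<le> t" "t \<le> K + 1" for t
  proof (cases "t = 1")
    case False
    with that have "t - 1 \<in> {1..K}" "t - 1 + 1 = t" by auto
    with xA[of "t - 1"] show ?thesis by (simp add: is_arg_min_def)
  qed (use run in \<open>simp add: LPD_run_def\<close>)
  have step: "q t + (A *v (x (t + 1) - xt t)) \<bullet> (y (t + 1) - v)
      + \<mu> * c t / 2 * (norm (u - x (t + 1)))\<^sup>2 + m t / 2 * (norm (x (t + 1) - x t))\<^sup>2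
      + rtau t / 2 * (norm (v - y (t + 1)))\<^sup>2 + rtau t / 2 * (norm (y (t + 1) - y t))\<^sup>2
    \<le> \<mu> * (c t - 1) / 2 * (norm (u - x t))\<^sup>2 + rtau t / 2 * (norm (v - y t))\<^sup>2"
    if t: "t \<in> {1..K}" for t
    using LPD_step[OF X Y grad lip sc g xX yA[OF t] xA[OF t] u v] t re[of t]
    by (simp add: q_def right_diff_distrib)
  have cstep: "c t * q t + c t * ((A *v (x (t + 1) - xt t)) \<bullet> (y (t + 1) - v))
      + \<mu> * (c t)\<^sup>2 / 2 * (norm (u - x (t + 1)))\<^sup>2 + c t * m t / 2 * (norm (x (t + 1) - x t))\<^sup>2
      + c t * rtau t / 2 * (norm (v - y (t + 1)))\<^sup>2 + c t * rtau t / 2 * (norm (y (t + 1) - y t))\<^sup>2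
    \<le> \<mu> * (c t * (c t - 1)) / 2 * (norm (u - x t))\<^sup>2 + c t * rtau t / 2 * (norm (v - y t))\<^sup>2"
    if t: "t \<in> {1..K}" for t
    using mult_left_mono[OF step[OF t], of "c t"] c_pos[of t]
    by (simp add: distrib_left power2_eq_square mult_ac)
  \<comment> \<open>This form shows that the product decreases in \<open>t\<close>, and at
    \<open>t = 1\<close> it gives the constant in front of the \<open>y\<close>-distance in the
    bound.\<close>
  have crt: "c t * rtau t = 4 * a\<^sup>2 / \<mu> * (1 + 2 * \<kappa> / (real t + 1))" if "t \<ge> 1" for t
    using \<mu> by (simp add: c rt[OF that] m_def divide_simps)
  have crt_mono: "c (n + 1) * rtau (n + 1) \<le> c n * rtau n" if "n \<ge> 1" for n
  proof -
    have "2 * \<kappa> / (real (n + 1) + 1) \<le> 2 * \<kappa> / (real n + 1)"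
      using \<kappa> by (intro divide_left_mono) auto
    then show ?thesis
      using \<mu> that by (simp only: crt) (intro mult_left_mono, auto simp: crt)
  qed
  \<comment> \<open>The left side keeps what the next iteration consumes: its own bilinear term will
    cancel the one here, Young's inequality uses the \<open>m n\<close> term, and the two distances
    to \<open>(u, v)\<close> replace those on the right of \<open>cstep\<close>. The increment of
    \<open>y\<close> is not carried along.\<close>
  have potential: "(\<Sum>t=1..n. c t * q t) + c n * ((A *v (x (n + 1) - x n)) \<bullet> (y (n + 1) - v))
      + \<mu> * (c n)\<^sup>2 / 2 * (norm (u - x (n + 1)))\<^sup>2 + c n * m n / 2 * (norm (x (n + 1) - x n))\<^sup>2
      + c n * rtau n / 2 * (norm (v - y (n + 1)))\<^sup>2 \<le> ?B"
    if "1 \<le> n" "n \<le> K" for n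
    using that
  proof (induction n rule: nat_induct_at_least)
    case base
    \<comment> \<open>There is no extrapolation at the start, so the bilinear term of the first
      iteration already has the form required by the invariant.\<close>
    have x1: "xt 1 = x 1" using run by (simp add: LPD_run_def)
    have c1: "c 1 = 1 + \<kappa>" by (simp add: c)
    \<comment> \<open>As \<open>\<mu> * \<kappa> = L\<close>, the left side equals
      \<open>(1 + \<kappa>) * L\<close>.\<close>
    have "\<mu> * (c 1 * (c 1 - 1)) \<le> (1 + \<kappa>) * (\<mu> + L)"
    proof -
      have "L = \<mu> * \<kappa>" using \<mu> by (simp add: \<kappa>_def)
      then have "\<mu> * (c 1 * (c 1 - 1)) = (1 + \<kappa>) * (\<mu> + L) - \<mu> * (1 + \<kappa>)"
        unfolding c1 by (simp add: algebra_simps)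
      then show ?thesis using \<mu> \<kappa> by simp
    qed
    then have "\<mu> * (c 1 * (c 1 - 1)) / 2 * (norm (u - x 1))\<^sup>2
        \<le> (1 + \<kappa>) * (\<mu> + L) / 2 * (norm (u - x 1))\<^sup>2"
      by (intro mult_right_mono) auto
    moreover have "c 1 * rtau 1 = (1 + \<kappa>) * (4 * a\<^sup>2 / \<mu>)"
      by (simp add: crt)
    moreover have "0 \<le> c 1 * rtau 1 / 2 * (norm (y (1 + 1) - y 1))\<^sup>2"
      using c_pos[of 1] rt_nonneg[of 1] by simp
    moreover have "?B = (1 + \<kappa>) * (\<mu> + L) / 2 * (norm (u - x 1))\<^sup>2
        + (1 + \<kappa>) * (4 * a\<^sup>2 / \<mu>) / 2 * (norm (v - y 1))\<^sup>2"
      using \<mu> unfolding \<kappa>_def[symmetric] a_def[symmetric] by (simp add: field_simps)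
    ultimately show ?case
      using cstep[of 1] K unfolding x1 by simp
  next
    case (Suc n)
    define t where "t = n + 1"
    have t: "t \<in> {1..K}" "t \<ge> 1" and n: "n \<in> {1..K}" using Suc by (auto simp: t_def)
    have cc: "c n = c t - 1 / 2" by (simp add: c t_def field_simps)
    \<comment> \<open>The parameter rule is given for \<open>\<theta> (t - 1)\<close>, and
      \<open>t - 1 = n\<close>.\<close>
    have "\<theta> n = c n / c t"
      using \<theta>[of t] by (simp add: t_def c \<kappa>_def)
    then have c\<theta>: "c t * \<theta> n = c n" using c_pos[of t] by simp
    have "x (t + 1) - xt t = (x (t + 1) - x t) - \<theta> n *\<^sub>R (x t - x n)"
      using xtS[OF n] by (simp add: t_def)
    then have "A *v (x (t + 1) - xt t)
        = A *v (x (t + 1) - x t) - \<theta> n *\<^sub>R (A *v (x t - x n))"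
      by (simp only: matrix_vector_mult_diff_distrib matrix_vector_mult_scaleR)
    then have "c t * ((A *v (x (t + 1) - xt t)) \<bullet> (y (t + 1) - v))
        = c t * ((A *v (x (t + 1) - x t)) \<bullet> (y (t + 1) - v))
          - (c t * \<theta> n) * ((A *v (x t - x n)) \<bullet> (y (t + 1) - v))"
      by (simp only: inner_diff_left inner_scaleR_left right_diff_distrib mult.assoc)
    also have "(A *v (x t - x n)) \<bullet> (y (t + 1) - v)
        = (A *v (x t - x n)) \<bullet> (y t - v) + (A *v (x t - x n)) \<bullet> (y (t + 1) - y t)"
      by (simp only: inner_diff_right)
    finally have bil: "c t * ((A *v (x (t + 1) - xt t)) \<bullet> (y (t + 1) - v))
        = c t * ((A *v (x (t + 1) - x t)) \<bullet> (y (t + 1) - v))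
          - c n * ((A *v (x t - x n)) \<bullet> (y t - v))
          - c n * ((A *v (x t - x n)) \<bullet> (y (t + 1) - y t))"
      by (simp only: c\<theta> distrib_left diff_diff_eq)
    \<comment> \<open>The \<open>x\<close>-increment carries the index \<open>n\<close>, the
      \<open>y\<close>-increment the index \<open>t\<close>. The factor 4 in \<open>rtau\<close>
      leaves room for the growth from \<open>m n\<close> to \<open>m t\<close>.\<close>
    have "m t \<le> 4 * m n" using \<mu> by (simp add: m_def t_def)
    then have "1 \<le> 4 * m n / m t" using m_pos[of t] by simp
    then have "a\<^sup>2 * 1 \<le> a\<^sup>2 * (4 * m n / m t)" by (intro mult_left_mono) auto
    also have "\<dots> = m n * rtau t" using t by (simp add: rt)
    finally have "a\<^sup>2 \<le> m n * rtau t" by simp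
    then have "(c n * c n) * a\<^sup>2 \<le> (c n * c t) * (m n * rtau t)"
      using c_pos[of n] c_pos[of t] cc by (intro mult_mono) auto
    then have "(c n * a)\<^sup>2 \<le> (c n * m n) * (c t * rtau t)"
      by (simp add: power2_eq_square mult_ac)
    then have young: "c n * ((A *v (x t - x n)) \<bullet> (y (t + 1) - y t))
        \<le> c n * m n / 2 * (norm (x t - x n))\<^sup>2 + c t * rtau t / 2 * (norm (y (t + 1) - y t))\<^sup>2"
      using c_pos[of n] c_pos[of t] m_pos[of n] rt_nonneg[OF t(2)]
      by (intro matrix_inner_young) (auto simp: a_def)
    have "c t * (c t - 1) \<le> (c n)\<^sup>2"
      unfolding cc by (simp add: power2_eq_square algebra_simps)
    then have xd: "\<mu> * (c t * (c t - 1)) / 2 * (norm (u - x t))\<^sup>2 \<le> \<mu> * (c n)\<^sup>2 / 2 * (norm (u - x t))\<^sup>2"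
      using \<mu> by (intro mult_right_mono divide_right_mono mult_left_mono) auto
    have yd: "c t * rtau t / 2 * (norm (v - y t))\<^sup>2 \<le> c n * rtau n / 2 * (norm (v - y t))\<^sup>2"
      using crt_mono[OF Suc.hyps] by (intro mult_right_mono divide_right_mono) (auto simp: t_def)
    have "(\<Sum>t=1..t. c t * q t) = (\<Sum>t=1..n. c t * q t) + c t * q t"
      by (simp add: t_def)
    then have "(\<Sum>t=1..t. c t * q t) + c t * ((A *v (x (t + 1) - x t)) \<bullet> (y (t + 1) - v))
      + \<mu> * (c t)\<^sup>2 / 2 * (norm (u - x (t + 1)))\<^sup>2 + c t * m t / 2 * (norm (x (t + 1) - x t))\<^sup>2
      + c t * rtau t / 2 * (norm (v - y (t + 1)))\<^sup>2 \<le> ?B"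
      using cstep[OF t(1)] bil young xd yd Suc.IH[folded t_def] Suc.prems by linarith
    then show ?case by (simp only: t_def Suc_eq_plus1)
  qed
  \<comment> \<open>No iteration follows to cancel the last bilinear term. It is absorbed by the
    last \<open>x\<close>-increment and the remaining distance from \<open>y (K + 1)\<close> to
    \<open>v\<close>, both with index \<open>K\<close>.\<close>
  have "a\<^sup>2 \<le> 4 * a\<^sup>2" by simp
  also have "\<dots> = m K * rtau K" using m_pos[of K] K by (simp add: rt)
  finally have "(c K * c K) * a\<^sup>2 \<le> (c K * c K) * (m K * rtau K)"
    using c_pos[of K] by (intro mult_left_mono) auto
  then have "(c K * a)\<^sup>2 \<le> (c K * m K) * (c K * rtau K)"
    by (simp add: power2_eq_square mult_ac)
  then have "- (c K * ((A *v (x (K + 1) - x K)) \<bullet> (y (K + 1) - v)))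
      \<le> c K * m K / 2 * (norm (x (K + 1) - x K))\<^sup>2 + c K * rtau K / 2 * (norm (y (K + 1) - v))\<^sup>2"
    using c_pos[of K] m_pos[of K] rt_nonneg[OF K]
    by (intro matrix_inner_young) (auto simp: a_def)
  moreover have "0 \<le> \<mu> * (c K)\<^sup>2 / 2 * (norm (u - x (K + 1)))\<^sup>2" using \<mu> by simp
  ultimately have "(\<Sum>t=1..K. c t * q t) \<le> ?B"
    using potential[OF K order_refl] unfolding norm_minus_commute[of "y (K + 1)" v] by linarith
  then show ?thesis by (simp add: q_def)
qed

section \<open>The bound for the output and its gap\<close>

theorem theorem3p1:
  fixes X :: "(real^'n) set" and Y :: "(real^'m) set"
    and f :: "real^'n \<Rightarrow> real" and gf :: "real^'n \<Rightarrow> real^'n"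
    and g :: "real^'m \<Rightarrow> real"
    and A :: "real^'n^'m"
    and Lf \<mu> :: real
    and \<gamma> \<theta> reta rtau :: "nat \<Rightarrow> real"
    and x xt :: "nat \<Rightarrow> real^'n" and y :: "nat \<Rightarrow> real^'m"
    and K :: nat
  assumes "X \<noteq> {}" "compact X" "convex X"
    and "Y \<noteq> {}" "compact Y" "convex Y"
    and "convex_on X f" "gradient_on X f gf" "Lf-lipschitz_on X gf"
    and "\<mu> > 0" "strongly_convex_on X f gf \<mu>"
    and "convex_on Y g"
    and "\<And>t. t \<ge> 1 \<Longrightarrow> \<gamma> t = real t / 2 + Lf / \<mu>"
    and "\<And>t. t \<ge> 1 \<Longrightarrow>
           \<theta> (t - 1) = (real t / 2 + Lf / \<mu>) / ((real t + 1) / 2 + Lf / \<mu>)"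
    and "\<And>t. t \<ge> 1 \<Longrightarrow> reta t = \<mu> * ((real t + 1) / 2) + Lf"
    and "\<And>t. t \<ge> 1 \<Longrightarrow> rtau t = 4 * (onorm ((*v) A))\<^sup>2 / (\<mu> * ((real t + 1) / 2))"
    and "K \<ge> 1"
    and "LPD_run X Y gf g A \<theta> reta rtau K x xt y"
  shows "(\<forall>z\<in>X \<times> Y.
            Qgap f g A (LPD_average \<gamma> K x, LPD_average \<gamma> K y) z
              \<le> LPD_bound A Lf \<mu> K (x 1) (y 1) z)
       \<and> (\<exists>zmax\<in>X \<times> Y.
            (\<forall>z\<in>X \<times> Y. LPD_bound A Lf \<mu> K (x 1) (y 1) z \<le> LPD_bound A Lf \<mu> K (x 1) (y 1) zmax)
            \<and> Gap X Y f g A (LPD_average \<gamma> K x, LPD_average \<gamma> K y)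
                \<le> LPD_bound A Lf \<mu> K (x 1) (y 1) zmax)"
proof -
  let ?zbar = "(LPD_average \<gamma> K x, LPD_average \<gamma> K y)"
  let ?G = "real K * (real K + 3 + 4 * (Lf / \<mu>)) / 4"
  have L: "0 \<le> Lf / \<mu>"
    using lipschitz_on_nonneg[OF assms(9)] \<open>\<mu> > 0\<close> by simp
  have \<gamma>: "\<gamma> (t + 1) = (real t + 1) / 2 + Lf / \<mu>" for t
    using assms(13)[of "t + 1"] by (simp add: add.commute)
  have \<gamma>_nonneg: "0 \<le> \<gamma> (t + 1)" for t
    unfolding \<gamma> using L by simp
  have G: "(\<Sum>t=1..K. \<gamma> (t + 1)) = ?G"
    using sum_LPD_weights[of "Lf / \<mu>" K] unfolding \<gamma> by (simp add: add.commute)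
  have G_pos: "0 < ?G"
    using L \<open>K \<ge> 1\<close> by (intro divide_pos_pos mult_pos_pos) auto
  have xX: "x (t + 1) \<in> X" and yY: "y (t + 1) \<in> Y" if "t \<in> {1..K}" for t
    using assms(18) that unfolding LPD_run_def is_arg_min_def by blast+
  have bound: "Qgap f g A ?zbar z \<le> LPD_bound A Lf \<mu> K (x 1) (y 1) z" if z: "z \<in> X \<times> Y" for z
  proof -
    obtain u v where uv: "z = (u, v)" "u \<in> X" "v \<in> Y" using z by auto
    have "?G * Qgap f g A ?zbar z \<le> (\<Sum>t=1..K. \<gamma> (t + 1) * Qgap f g A (x (t + 1), y (t + 1)) z)"
      unfolding G[symmetric]
      by (rule Qgap_average_le[OF assms(3,6,7,12)], erule xX, erule yY, rule \<gamma>_nonneg)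
        (simp_all only: G G_pos)
    also have "\<dots> \<le> (1 + Lf / \<mu>) * ((\<mu> + Lf) / 2 * (norm (u - x 1))\<^sup>2
        + 4 * (onorm ((*v) A))\<^sup>2 / (2 * \<mu>) * (norm (v - y 1))\<^sup>2)"
      unfolding \<gamma> uv(1)
      by (rule LPD_telescope[OF assms(3,6,8-12,14-18) uv(2,3)])
    finally have "Qgap f g A ?zbar z \<le> (1 + Lf / \<mu>) * ((\<mu> + Lf) / 2 * (norm (u - x 1))\<^sup>2
        + 4 * (onorm ((*v) A))\<^sup>2 / (2 * \<mu>) * (norm (v - y 1))\<^sup>2) / ?G"
      using G_pos by (simp only: pos_le_divide_eq mult.commute[of _ ?G])
    also have "\<dots> = LPD_bound A Lf \<mu> K (x 1) (y 1) z"
      by (simp add: LPD_bound_def uv(1))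
    finally show ?thesis .
  qed
  \<comment> \<open>The bound is continuous on a compact product, so its maximum is attained.
    \<open>Gap\<close> is a supremum, and the value at \<open>zmax\<close> bounds every term of
    it.\<close>
  obtain zmax where zmax: "zmax \<in> X \<times> Y"
    "\<And>z. z \<in> X \<times> Y \<Longrightarrow> LPD_bound A Lf \<mu> K (x 1) (y 1) z \<le> LPD_bound A Lf \<mu> K (x 1) (y 1) zmax"
    using continuous_attains_sup[OF compact_Times[OF assms(2,5)] _ continuous_LPD_bound] assms(1,4)
    by blast
  have "Gap X Y f g A ?zbar \<le> LPD_bound A Lf \<mu> K (x 1) (y 1) zmax"
    unfolding Gap_def
  proof (rule cSUP_least)
    show "X \<times> Y \<noteq> {}" using zmax(1) by blast
  qed (rule order_trans[OF bound zmax(2)])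
  with bound zmax show ?thesis by blast
qed

end
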